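(* Let $p$ be an odd prime, and let $\mathrm{E}_p(X)=\sum_{n=0}^{\infty} a_n X^n\in\mathbb{F}_p[[X]]$ be the reduction modulo $p$ of the Artin-Hasse exponential series. Let $T(X)=\sum_{i=1}^{\infty}X^{p^i}\in\mathbb{F}_p[[X]]$. Then in $\mathbb{F}_p[[X]]$ we have \[ L_{p-1}^{(-T(X))}(X)=\mathrm{E}_p(X)\cdot \sum_{n=0}^{\infty}(-1)^n a_{np}X^{np}, \] and \[ L_{p-1}^{(-T(X))}(X)\cdot T(X)\cdot \sum_{n=0}^{\infty} a_{np}X^{np}=X^p\,\mathrm{E}_p(X). \]
   Context: The Artin-Hasse exponential series is $\mathrm{AH}(X)=\exp\bigl(\sum_{i=0}^{\infty}X^{p^i}/p^i\bigr)\in\mathbb{Q}[[X]]$; its coefficients are $p$-integral, so it can be reduced modulo $p$, giving $\mathrm{E}_p(X)\in\mathbb{F}_p[[X]]$. For a prime $p$, the (generalized) Laguerre polynomial of degree $p-1$ is the polynomial in $\mathbb{F}_p[\alpha,X]$ given by \[ L_{p-1}^{(\alpha)}(X)=\sum_{k=0}^{p-1}\binom{\alpha-1}{p-1-k}\frac{(-X)^k}{k!} \] (the reduction modulo $p$ of the classical $L_{p-1}^{(\alpha)}(X)=\sum_{k=0}^{p-1}\binom{\alpha+p-1}{p-1-k}\frac{(-X)^k}{k!}$). The series $L_{p-1}^{(-T(X))}(X)\in\mathbb{F}_p[[X]]$ is obtained by substituting $\alpha=-T(X)$. *)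

theory Defs
  imports "Berlekamp_Zassenhaus.Finite_Field" "HOL-Computational_Algebra.Formal_Power_Series"
begin

text \<open>The field F_p is modelled by the type 'p mod_ring with p = CARD('p) prime.\<close>

definition AH_log :: "nat \<Rightarrow> rat fps" where
  "AH_log p = Abs_fps (\<lambda>n. if (\<exists>i. n = p ^ i) then 1 / of_nat n else 0)"

definition artin_hasse :: "nat \<Rightarrow> rat fps" where
  "artin_hasse p = fps_compose (fps_exp 1) (AH_log p)"

text \<open>Reduction modulo p of a rational a/b (in lowest terms), meaningful when p does not divide b.\<close>
definition red_mod :: "rat \<Rightarrow> 'p::prime_card mod_ring" where
  "red_mod q = (case quotient_of q of (a, b) \<Rightarrow> of_int a / of_int b)"

definition E_p :: "'p::prime_card mod_ring fps" where
  "E_p = Abs_fps (\<lambda>n. red_mod (fps_nth (artin_hasse CARD('p)) n))"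

definition T_p :: "'p::prime_card mod_ring fps" where
  "T_p = Abs_fps (\<lambda>n. if (\<exists>i\<ge>1. n = CARD('p) ^ i) then 1 else 0)"

text \<open>Binomial coefficient (x choose m) = x(x-1)...(x-m+1)/m!, for m < p.\<close>
definition binom_fps :: "'a::field fps \<Rightarrow> nat \<Rightarrow> 'a fps" where
  "binom_fps x m = fps_const (inverse (of_nat (fact m) :: 'a)) * (\<Prod>j<m. x - of_nat j)"

definition laguerre_p :: "'p::prime_card mod_ring fps \<Rightarrow> 'p mod_ring fps" where
  "laguerre_p \<alpha> = (\<Sum>k\<le>CARD('p) - 1.
      binom_fps (\<alpha> - 1) (CARD('p) - 1 - k) * (- fps_X) ^ k * fps_const (inverse (of_nat (fact k) :: 'p mod_ring)))"

end

theory Submission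
  imports Defs
begin

text \<open>
  Let \<open>L\<close> be the Laguerre polynomial at \<open>\<alpha> = - T\<close> and \<open>A\<close> the part of \<open>E = E\<^sub>p\<close> supported on exponents
  divisible by \<open>p\<close>. Since \<open>T - T^p = X^p\<close>, both \<open>L\<close> and \<open>E\<close> solve \<open>X f' = (X + T) f\<close>. As
  \<open>E(X) E(-X) = 1\<close>, the quotient \<open>S = L(X) E(-X)\<close> has derivative \<open>0\<close>, so it is a series in \<open>X^p\<close>.
  Taking the part supported on multiples of \<open>p\<close> in \<open>L = S E\<close> gives \<open>S A = 1 - T^(p-1)\<close>, and
  \<open>T (1 - T^(p-1)) = X^p\<close> yields the second identity. Moreover \<open>S(X) S(-X) = L(X) L(-X)\<close> is a series
  in \<open>X^p\<close>, which Chu--Vandermonde evaluates to \<open>1 - T^(p-1)\<close> as well; hence \<open>S(-X) = A(X)\<close>, which is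
  the first identity.
\<close>

unbundle fps_syntax

subsection \<open>Characteristic \<open>p\<close>\<close>

lemma fps_nth_compose_X_power:
  fixes f :: "'a::comm_ring_1 fps"
  assumes "m > 0"
  shows "(f oo fps_X ^ m) $ n = (if m dvd n then f $ (n div m) else 0)"
proof -
  have "(f oo fps_X ^ m) $ n = (\<Sum>i\<in>{0..n}. if n = m * i then f $ i else 0)"
    unfolding fps_compose_nth by (intro sum.cong) (auto simp flip: power_mult)
  also have "\<dots> = (if m dvd n then f $ (n div m) else 0)"
  proof (cases "m dvd n")
    case True
    then have "(n = m * i) = (i = n div m)" for i using assms by auto
    then show ?thesis using True by simp
  next
    case False
    then show ?thesis by (auto intro!: sum.neutral)
  qed
  finally show ?thesis .
qed

text \<open>The freshman's dream covers finite sums only, so for the coefficient of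
  \<open>X^n\<close> the series is split into its polynomial part of degree at most \<open>n\<close>
  and a tail divisible by \<open>X^(n+1)\<close>. Fermat's theorem fixes the coefficients of the
  polynomial part, and the \<open>p\<close>-th power of the tail starts beyond
  \<open>X^n\<close>.\<close>

lemma fps_frobenius:
  fixes f :: "'p::prime_card mod_ring fps"
  shows "f ^ CARD('p) = f oo fps_X ^ CARD('p)"
proof (rule fps_ext)
  fix n
  let ?p = "CARD('p)"
  have pr: "prime CHAR('p mod_ring fps)" by (simp add: prime_card)
  have p: "?p = CHAR('p mod_ring fps)" by simp
  have p0: "?p > 0" by simp
  let ?g = "\<Sum>i\<in>{0..n}. fps_const (f $ i) * fps_X ^ i"
  let ?h = "fps_shift (Suc n) f"
  have cut: "?g = fps_cutoff (Suc n) f"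
    by (rule fps_ext) (simp add: fps_sum_nth if_distrib less_Suc_eq_le cong: if_cong)
  have "f = ?g + fps_X ^ Suc n * ?h"
    unfolding cut by (subst add.commute) (rule fps_shift_cutoff'[symmetric])
  then have "f ^ ?p = (?g + fps_X ^ Suc n * ?h) ^ ?p" by (rule arg_cong)
  also have "\<dots> = ?g ^ ?p + (fps_X ^ Suc n * ?h) ^ ?p"
    by (rule freshmans_dream[OF pr p])
  also have "?g ^ ?p = (\<Sum>i\<in>{0..n}. fps_const (f $ i) * (fps_X ^ ?p) ^ i)"
    unfolding freshmans_dream_sum[OF pr p]
  proof (intro sum.cong refl)
    fix i
    have "(f $ i) ^ ?p = f $ i"
      using finite_field_power_card_eq_same[of "f $ i"] by simp
    then show "(fps_const (f $ i) * fps_X ^ i) ^ ?p = fps_const (f $ i) * (fps_X ^ ?p) ^ i"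
      by (simp add: power_mult_distrib fps_const_power mult.commute flip: power_mult)
  qed
  also have "(fps_X ^ Suc n * ?h) ^ ?p = fps_X ^ (Suc n * ?p) * ?h ^ ?p"
    by (simp only: power_mult_distrib power_mult)
  finally have "f ^ ?p $ n = (\<Sum>i\<in>{0..n}. f $ i * (fps_X ^ ?p) ^ i $ n) + (fps_X ^ (Suc n * ?p) * ?h ^ ?p) $ n"
    by (simp add: fps_sum_nth)
  moreover have "n < Suc n * ?p"
    using p0 by (cases ?p) auto
  ultimately show "f ^ ?p $ n = (f oo fps_X ^ ?p) $ n"
    by (simp add: fps_compose_nth fps_X_power_mult_nth del: power_Suc)
qed

text \<open>As polynomials in \<open>x\<close>, both sides are monic of degree \<open>p\<close> and
  vanish at the \<open>p\<close> distinct points \<open>- i\<close> with \<open>i < p\<close>, so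
  they coincide.\<close>

lemma pochhammer_CHAR:
  fixes x :: "'a::idom"
  assumes "prime CHAR('a)"
  shows "pochhammer x CHAR('a) = x ^ CHAR('a) - x"
proof -
  let ?p = "CHAR('a)"
  have p1: "1 < ?p" using assms prime_gt_1_nat by blast
  have fermat: "of_nat i ^ ?p = (of_nat i :: 'a)" for i
    using p1 by (induction i) (simp_all add: freshmans_dream[OF assms refl] power_0_left)
  \<comment> \<open>Expanding \<open>((-1) + 1)^p\<close> gives this without separating
    \<open>p = 2\<close> from odd \<open>p\<close>.\<close>
  have minus: "(- 1) ^ ?p = (- 1 :: 'a)"
    using freshmans_dream[OF assms refl, of "-1" 1] p1 by (simp add: eq_neg_iff_add_eq_0 power_0_left)
  let ?P = "\<Prod>i<?p. [:of_nat i, 1 :: 'a:]"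
  let ?Q = "monom 1 ?p - monom 1 1 :: 'a poly"
  let ?A = "(\<lambda>i. - of_nat i :: 'a) ` {..<?p}"
  have inj: "inj_on (\<lambda>i. - of_nat i :: 'a) {..<?p}"
    by (auto intro!: inj_onI simp: of_nat_eq_iff_cong_CHAR cong_def)
  have deg: "degree ?P = ?p" by (subst degree_prod_eq_sum_degree) auto
  have "?P = ?Q"
  proof (rule poly_eqI_degree_lead_coeff[where n = ?p and A = ?A])
    show "coeff ?P ?p = coeff ?Q ?p"
      using p1 lead_coeff_prod[of "\<lambda>i. [:of_nat i, 1 :: 'a:]" "{..<?p}"] by (simp add: deg)
    show "card ?A \<ge> ?p" using inj by (simp add: card_image)
    show "degree ?P \<le> ?p" using deg by simp
    show "degree ?Q \<le> ?p"
      using p1 by (intro degree_diff_le) (auto simp: degree_monom_eq)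
    show "poly ?P z = poly ?Q z" if "z \<in> ?A" for z
    proof -
      from that obtain j where j: "j < ?p" "z = - of_nat j" by auto
      have "z ^ ?p = z"
        unfolding j(2) by (subst power_minus) (simp add: minus fermat)
      moreover have "poly ?P z = 0"
        using j by (auto simp: poly_prod intro!: prod_zero bexI[of _ j])
      ultimately show ?thesis by (simp add: poly_monom)
    qed
  qed
  then have "poly ?P x = poly ?Q x" by simp
  then show ?thesis
    by (simp add: poly_prod poly_monom pochhammer_prod atLeast0LessThan add.commute)
qed

text \<open>Pascal's rule writes \<open>p choose (k + 1)\<close>, a multiple of \<open>p\<close>, as
  the sum of two neighbours in row \<open>p - 1\<close>. Neighbours are therefore opposite, starting
  from 1.\<close>

lemma of_nat_binomial_CHAR_minus_1:
  assumes "prime CHAR('a::comm_ring_1)" "k < CHAR('a)"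
  shows "of_nat ((CHAR('a) - 1) choose k) = ((- 1) ^ k :: 'a)"
  using assms(2)
proof (induction k)
  case (Suc k)
  let ?p = "CHAR('a)"
  have "?p choose Suc k = ((?p - 1) choose k) + ((?p - 1) choose Suc k)"
    using Suc.prems by (cases ?p) auto
  moreover have "?p dvd ?p choose Suc k"
    using Suc.prems by (intro dvd_choose_prime assms) auto
  ultimately have "of_nat ((?p - 1) choose k) + of_nat ((?p - 1) choose Suc k) = (0 :: 'a)"
    by (metis of_nat_add of_nat_eq_0_iff_char_dvd)
  then show ?case using Suc by (simp add: eq_neg_iff_add_eq_0 add.commute)
qed simp

subsection \<open>Reduction of \<open>p\<close>-integral power series\<close>

text \<open>Any fraction with denominator prime to \<open>p\<close> is allowed, not only the one in
  lowest terms, so closure under sums and products needs no cancellation.\<close>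

definition p_integral :: "nat \<Rightarrow> rat \<Rightarrow> bool" where
  "p_integral p q \<longleftrightarrow> (\<exists>a b. \<not> int p dvd b \<and> q = of_int a / of_int b)"

lemma of_int_mod_ring_eq_0_iff:
  "of_int a = (0 :: 'p::prime_card mod_ring) \<longleftrightarrow> int CARD('p) dvd a"
  using of_int_eq_0_iff_char_dvd[where 'a = "'p mod_ring"] by simp

text \<open>The lowest-terms denominator \<open>d\<close> divides \<open>b\<close>, hence is also
  invertible modulo \<open>p\<close>, and the integer identity \<open>a * d = c * b\<close> passes
  to the field. The residue can thus be read off from any admissible fraction.\<close>

lemma red_mod_divide:
  assumes "\<not> int CARD('p) dvd b"
  shows "red_mod (of_int a / of_int b) = (of_int a / of_int b :: 'p::prime_card mod_ring)"
proof -
  obtain c d where cd: "quotient_of (of_int a / of_int b) = (c, d)" by fastforce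
  have b0: "b \<noteq> 0" using assms by auto
  have d0: "d > 0" using quotient_of_denom_pos[OF cd] .
  have "of_int a / of_int b = (of_int c / of_int d :: rat)" using quotient_of_div[OF cd] .
  then have "of_int (a * d) = (of_int (c * b) :: rat)"
    using b0 d0 by (simp add: field_simps)
  then have eq: "a * d = c * b" by (simp only: of_int_eq_iff)
  then have "d dvd c * b" by (metis dvd_triv_right)
  then have "d dvd b" using quotient_of_coprime[OF cd]
    by (simp add: coprime_commute coprime_dvd_mult_right_iff)
  then have "\<not> int CARD('p) dvd d" using assms dvd_trans by blast
  then have nz: "of_int b \<noteq> (0 :: 'p mod_ring)" "of_int d \<noteq> (0 :: 'p mod_ring)"
    using assms by (simp_all add: of_int_mod_ring_eq_0_iff)
  have "of_int a * of_int d = (of_int c * of_int b :: 'p mod_ring)"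
    using eq by (metis of_int_mult)
  then have "of_int c / of_int d = (of_int a / of_int b :: 'p mod_ring)"
    using nz by (simp add: field_simps)
  then show ?thesis by (simp add: red_mod_def cd)
qed

lemma p_integralE:
  assumes "p_integral CARD('p::prime_card) q"
  obtains a b where "q = of_int a / of_int b" "\<not> int CARD('p) dvd b" "b \<noteq> 0"
    "of_int b \<noteq> (0 :: 'p mod_ring)" "red_mod q = (of_int a / of_int b :: 'p mod_ring)"
proof -
  from assms obtain a b where ab: "q = of_int a / of_int b" "\<not> int CARD('p) dvd b"
    unfolding p_integral_def by blast
  then have "b \<noteq> 0" by auto
  with ab show ?thesis
    by (intro that[of a b]) (simp_all add: of_int_mod_ring_eq_0_iff red_mod_divide)
qed

lemma p_integral_of_int: "prime p \<Longrightarrow> p_integral p (of_int a)"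
  unfolding p_integral_def by (rule exI[of _ a], rule exI[of _ 1]) (auto simp: prime_nat_iff)

lemma red_mod_of_int [simp]: "red_mod (of_int a) = (of_int a :: 'p::prime_card mod_ring)"
  using red_mod_divide[of 1 a, where 'p = 'p] nontriv[where 'a = 'p] by simp

lemma red_mod_of_nat [simp]: "red_mod (of_nat a) = (of_nat a :: 'p::prime_card mod_ring)"
  using red_mod_of_int[of "int a"] by simp

lemma red_mod_0 [simp]: "red_mod 0 = 0" and red_mod_1 [simp]: "red_mod 1 = 1"
  using red_mod_of_int[of 0] red_mod_of_int[of 1] by simp_all

context
  fixes x y :: rat
  assumes x: "p_integral CARD('p::prime_card) x" and y: "p_integral CARD('p) y"
begin

lemma p_integral_add: "p_integral CARD('p) (x + y)"
  and red_mod_add: "red_mod (x + y) = (red_mod x + red_mod y :: 'p mod_ring)"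
proof -
  from x obtain a b where ab: "x = of_int a / of_int b" "\<not> int CARD('p) dvd b" "b \<noteq> 0"
    "of_int b \<noteq> (0 :: 'p mod_ring)" "red_mod x = (of_int a / of_int b :: 'p mod_ring)"
    by (rule p_integralE)
  from y obtain c d where cd: "y = of_int c / of_int d" "\<not> int CARD('p) dvd d" "d \<noteq> 0"
    "of_int d \<noteq> (0 :: 'p mod_ring)" "red_mod y = (of_int c / of_int d :: 'p mod_ring)"
    by (rule p_integralE)
  have eq: "x + y = of_int (a * d + c * b) / of_int (b * d)"
    using ab cd by (simp add: field_simps)
  have nd: "\<not> int CARD('p) dvd b * d"
    using ab cd prime_card_int[where 'a = 'p] by (simp add: prime_dvd_mult_iff)
  show "p_integral CARD('p) (x + y)" using eq nd unfolding p_integral_def by blast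
  show "red_mod (x + y) = (red_mod x + red_mod y :: 'p mod_ring)"
    unfolding eq red_mod_divide[OF nd] using ab cd by (simp add: field_simps)
qed

lemma p_integral_mult: "p_integral CARD('p) (x * y)"
  and red_mod_mult: "red_mod (x * y) = (red_mod x * red_mod y :: 'p mod_ring)"
proof -
  from x obtain a b where ab: "x = of_int a / of_int b" "\<not> int CARD('p) dvd b" "b \<noteq> 0"
    "of_int b \<noteq> (0 :: 'p mod_ring)" "red_mod x = (of_int a / of_int b :: 'p mod_ring)"
    by (rule p_integralE)
  from y obtain c d where cd: "y = of_int c / of_int d" "\<not> int CARD('p) dvd d" "d \<noteq> 0"
    "of_int d \<noteq> (0 :: 'p mod_ring)" "red_mod y = (of_int c / of_int d :: 'p mod_ring)"
    by (rule p_integralE)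
  have eq: "x * y = of_int (a * c) / of_int (b * d)"
    using ab cd by (simp add: field_simps)
  have nd: "\<not> int CARD('p) dvd b * d"
    using ab cd prime_card_int[where 'a = 'p] by (simp add: prime_dvd_mult_iff)
  show "p_integral CARD('p) (x * y)" using eq nd unfolding p_integral_def by blast
  show "red_mod (x * y) = (red_mod x * red_mod y :: 'p mod_ring)"
    unfolding eq red_mod_divide[OF nd] using ab cd by (simp add: field_simps)
qed

end

lemma
  assumes "\<And>i. i \<in> I \<Longrightarrow> p_integral CARD('p::prime_card) (f i)"
  shows p_integral_sum: "p_integral CARD('p) (sum f I)"
    and red_mod_sum: "red_mod (sum f I) = (\<Sum>i\<in>I. red_mod (f i) :: 'p mod_ring)"
proof -
  have "p_integral CARD('p) (sum f I) \<and> red_mod (sum f I) = (\<Sum>i\<in>I. red_mod (f i) :: 'p mod_ring)"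
    using assms
  proof (induction I rule: infinite_finite_induct)
    case (insert i I)
    then show ?case by (simp add: p_integral_add red_mod_add)
  qed (use p_integral_of_int[OF prime_card[where 'a = 'p], of 0] in simp_all)
  then show "p_integral CARD('p) (sum f I)"
    and "red_mod (sum f I) = (\<Sum>i\<in>I. red_mod (f i) :: 'p mod_ring)" by auto
qed

text \<open>A vanishing residue means that \<open>p\<close> divides the numerator of
  \<open>p * x\<close>, so one factor \<open>p\<close> can be cancelled. This is the division step
  in the integrality proof for the Artin-Hasse series.\<close>

lemma p_integral_if_red_mod_eq_0:
  assumes "p_integral CARD('p::prime_card) (of_nat CARD('p) * x)"
    "red_mod (of_nat CARD('p) * x) = (0 :: 'p mod_ring)"
  shows "p_integral CARD('p) x"
proof -
  from assms(1) obtain a b where ab: "of_nat CARD('p) * x = of_int a / of_int b"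
    "\<not> int CARD('p) dvd b" "b \<noteq> 0" "of_int b \<noteq> (0 :: 'p mod_ring)"
    "red_mod (of_nat CARD('p) * x) = (of_int a / of_int b :: 'p mod_ring)"
    by (rule p_integralE)
  then have "int CARD('p) dvd a" using assms(2) by (simp add: of_int_mod_ring_eq_0_iff)
  then obtain k where "a = int CARD('p) * k" by blast
  then have "x = of_int k / of_int b" using ab(1,3) by (simp add: field_simps)
  then show ?thesis using ab(2) unfolding p_integral_def by blast
qed

section \<open>Coefficientwise reduction of power series\<close>

definition fps_p_integral :: "nat \<Rightarrow> rat fps \<Rightarrow> bool" where
  "fps_p_integral p f \<longleftrightarrow> (\<forall>n. p_integral p (f $ n))"

definition fps_red :: "rat fps \<Rightarrow> 'p::prime_card mod_ring fps" where
  "fps_red f = Abs_fps (\<lambda>n. red_mod (f $ n))"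

lemma fps_red_nth [simp]: "fps_red f $ n = red_mod (f $ n)"
  by (simp add: fps_red_def)

lemma
  assumes "fps_p_integral CARD('p::prime_card) f" "fps_p_integral CARD('p) g"
  shows fps_p_integral_mult: "fps_p_integral CARD('p) (f * g)"
    and fps_red_mult: "fps_red (f * g) = (fps_red f * fps_red g :: 'p mod_ring fps)"
proof -
  have int: "p_integral CARD('p) (f $ i * g $ j)" for i j
    using assms by (simp add: fps_p_integral_def p_integral_mult)
  then show "fps_p_integral CARD('p) (f * g)"
    by (simp add: fps_p_integral_def fps_mult_nth p_integral_sum)
  show "fps_red (f * g) = (fps_red f * fps_red g :: 'p mod_ring fps)"
    using assms int
    by (intro fps_ext) (simp add: fps_mult_nth red_mod_sum red_mod_mult fps_p_integral_def)
qed

lemma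
  shows fps_p_integral_1: "fps_p_integral CARD('p::prime_card) 1"
    and fps_red_1 [simp]: "fps_red 1 = (1 :: 'p mod_ring fps)"
proof -
  show "fps_p_integral CARD('p) 1"
    using p_integral_of_int[OF prime_card[where 'a = 'p], of 0]
      p_integral_of_int[OF prime_card[where 'a = 'p], of 1]
    by (simp add: fps_p_integral_def)
  show "fps_red 1 = (1 :: 'p mod_ring fps)" by (rule fps_ext) simp
qed

lemma
  assumes "fps_p_integral CARD('p::prime_card) f"
  shows fps_p_integral_power: "fps_p_integral CARD('p) (f ^ n)"
    and fps_red_power: "fps_red (f ^ n) = (fps_red f ^ n :: 'p mod_ring fps)"
proof -
  have "fps_p_integral CARD('p) (f ^ n) \<and> fps_red (f ^ n) = (fps_red f ^ n :: 'p mod_ring fps)"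
    by (induction n) (simp_all add: assms fps_p_integral_1 fps_p_integral_mult fps_red_mult)
  then show "fps_p_integral CARD('p) (f ^ n)"
    and "fps_red (f ^ n) = (fps_red f ^ n :: 'p mod_ring fps)" by auto
qed

lemma
  assumes "fps_p_integral CARD('p::prime_card) f" "m > 0"
  shows fps_p_integral_compose_X_power: "fps_p_integral CARD('p) (f oo fps_X ^ m)"
    and fps_red_compose_X_power:
      "fps_red (f oo fps_X ^ m) = (fps_red f oo fps_X ^ m :: 'p mod_ring fps)"
proof -
  show "fps_p_integral CARD('p) (f oo fps_X ^ m)"
    using assms p_integral_of_int[OF prime_card[where 'a = 'p], of 0]
    by (simp add: fps_p_integral_def fps_nth_compose_X_power)
  show "fps_red (f oo fps_X ^ m) = (fps_red f oo fps_X ^ m :: 'p mod_ring fps)"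
    using assms(2) by (intro fps_ext) (simp add: fps_nth_compose_X_power)
qed

lemma
  assumes "fps_p_integral CARD('p::prime_card) f"
  shows fps_p_integral_compose_uminus: "fps_p_integral CARD('p) (f oo - fps_X)"
    and fps_red_compose_uminus:
      "fps_red (f oo - fps_X) = (fps_red f oo - fps_X :: 'p mod_ring fps)"
proof -
  have m: "p_integral CARD('p) ((- 1) ^ n)" "red_mod ((- 1) ^ n) = ((- 1) ^ n :: 'p mod_ring)" for n
    using p_integral_of_int[OF prime_card[where 'a = 'p], of "(-1) ^ n"]
      red_mod_of_int[of "(-1) ^ n", where 'p = 'p] by simp_all
  show "fps_p_integral CARD('p) (f oo - fps_X)"
    using assms m by (simp add: fps_p_integral_def fps_compose_uminus' p_integral_mult)
  show "fps_red (f oo - fps_X) = (fps_red f oo - fps_X :: 'p mod_ring fps)"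
    using assms m
    by (intro fps_ext) (simp add: fps_p_integral_def fps_compose_uminus' red_mod_mult)
qed

section \<open>Divisibility of factorials by p and the series exp(pX)\<close>

lemma fact_eq_prime_power_times:
  assumes "prime (p :: nat)"
  shows "\<exists>u. fact n = p ^ (n div p) * fact (n div p) * u \<and> \<not> p dvd u"
proof (induction n)
  case 0
  then show ?case using assms by (intro exI[of _ 1]) (auto simp: prime_nat_iff)
next
  case (Suc n)
  then obtain u where u: "fact n = p ^ (n div p) * fact (n div p) * u" "\<not> p dvd u" by blast
  show ?case
  \<comment> \<open>A multiple of \<open>p\<close> contributes one factor \<open>p\<close> and the
    next factor of \<open>fact (n div p)\<close>; every other number is absorbed into the cofactor
    \<open>u\<close>.\<close>
  proof (cases "p dvd Suc n")
    case True
    then have d: "Suc n div p = Suc (n div p)" by (simp add: div_Suc dvd_eq_mod_eq_0)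
    with True have s: "Suc n = p * Suc (n div p)" by (metis dvd_mult_div_cancel)
    have "fact (Suc n) = Suc n * fact n" by simp
    also have "\<dots> = p ^ (Suc n div p) * fact (Suc n div p) * u"
      unfolding d u(1) by (subst s) (simp only: fact_Suc power_Suc of_nat_id mult_ac)
    finally show ?thesis using u(2) by blast
  next
    case False
    then have d: "Suc n div p = n div p" by (simp add: div_Suc dvd_eq_mod_eq_0)
    have "fact (Suc n) = Suc n * fact n" by simp
    also have "\<dots> = p ^ (Suc n div p) * fact (Suc n div p) * (u * Suc n)"
      unfolding d u(1) by (simp only: mult_ac)
    finally have "fact (Suc n) = p ^ (Suc n div p) * fact (Suc n div p) * (u * Suc n)" .
    moreover have "\<not> p dvd u * Suc n" using u(2) False assms prime_dvd_multD by blast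
    ultimately show ?thesis by blast
  qed
qed

text \<open>With \<open>q = n div p\<close>, the valuation of \<open>n!\<close> is \<open>q\<close>
  plus that of \<open>q!\<close>, which by induction is below \<open>2 * q\<close>, hence below
  \<open>n\<close>. Strictness is what makes \<open>p^n / n!\<close> vanish modulo \<open>p\<close>
  for \<open>n > 0\<close>.\<close>

lemma fact_prime_valuation_less:
  assumes "prime (p :: nat)" "n > 0"
  shows "\<exists>v<n. \<exists>b. fact n = p ^ v * b \<and> \<not> p dvd b"
  using assms(2)
proof (induction n rule: less_induct)
  case (less n)
  let ?q = "n div p"
  have p2: "p \<ge> 2" using assms prime_ge_2_nat by blast
  obtain u where u: "fact n = p ^ ?q * fact ?q * u" "\<not> p dvd u"
    using fact_eq_prime_power_times[OF assms(1)] by blast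
  show ?case
  proof (cases "?q = 0")
    case True
    then show ?thesis using u less.prems by (intro exI[of _ 0] conjI exI[of _ u]) auto
  next
    case False
    moreover have "?q < n" using p2 less.prems by simp
    ultimately obtain w b where w: "w < ?q" "fact ?q = p ^ w * b" "\<not> p dvd b"
      using less.IH[of ?q] by auto
    have "?q + w < 2 * ?q" using w by simp
    also have "\<dots> \<le> p * ?q" using p2 by simp
    also have "\<dots> \<le> n" by simp
    finally have "?q + w < n" .
    moreover have "fact n = p ^ (?q + w) * (b * u)"
      using u(1) unfolding w(2) by (simp only: power_add mult_ac)
    moreover have "\<not> p dvd b * u" using w u assms by (simp add: prime_dvd_mult_iff)
    ultimately show ?thesis by blast
  qed
qed

lemma
  shows fps_p_integral_exp_CARD: "fps_p_integral CARD('p::prime_card) (fps_exp (of_nat CARD('p)))"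
    and fps_red_exp_CARD: "fps_red (fps_exp (of_nat CARD('p))) = (1 :: 'p mod_ring fps)"
proof -
  have *: "p_integral CARD('p) (fps_exp (of_nat CARD('p)) $ n) \<and>
    red_mod (fps_exp (of_nat CARD('p)) $ n) = ((1 :: 'p mod_ring fps) $ n)" for n
  proof (cases "n = 0")
    case True
    then show ?thesis using p_integral_of_int[OF prime_card[where 'a = 'p], of 1] by simp
  next
    case False
    then obtain v b where v: "v < n" "fact n = CARD('p) ^ v * b" "\<not> CARD('p) dvd b"
      using fact_prime_valuation_less[OF prime_card[where 'a = 'p], of n] by auto
    have b0: "b \<noteq> 0" using v by (metis dvd_0_right)
    have "fact n = (of_nat (CARD('p) ^ v * b) :: rat)" using v(2) by (metis of_nat_fact)
    then have "fps_exp (of_nat CARD('p)) $ n = of_nat CARD('p) ^ n / (of_nat CARD('p) ^ v * of_nat b :: rat)"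
      by simp
    also have "of_nat CARD('p) ^ n = (of_nat CARD('p) ^ v * of_nat CARD('p) ^ (n - v) :: rat)"
      using v(1) by (simp flip: power_add)
    also have "\<dots> / (of_nat CARD('p) ^ v * of_nat b) = of_int (int CARD('p) ^ (n - v)) / of_int (int b)"
      using b0 by simp
    finally have eq: "fps_exp (of_nat CARD('p)) $ n = of_int (int CARD('p) ^ (n - v)) / (of_int (int b) :: rat)" .
    have nd: "\<not> int CARD('p) dvd int b" using v(3) by simp
    have "p_integral CARD('p) (of_int (int CARD('p) ^ (n - v)) / of_int (int b))"
      using nd unfolding p_integral_def by blast
    then show ?thesis
      unfolding eq red_mod_divide[OF nd] using v(1) False by simp
  qed
  then show "fps_p_integral CARD('p) (fps_exp (of_nat CARD('p)))"
    by (simp add: fps_p_integral_def)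
  show "fps_red (fps_exp (of_nat CARD('p))) = (1 :: 'p mod_ring fps)"
    using * by (intro fps_ext) simp
qed

subsection \<open>The Artin--Hasse series\<close>

lemma AH_log_nth: "AH_log p $ n = (if \<exists>i. n = p ^ i then 1 / of_nat n else 0)"
  by (simp add: AH_log_def)

lemma AH_log_nth_0: "AH_log p $ 0 = 0"
  by (simp add: AH_log_nth)

lemma artin_hasse_nth_0: "artin_hasse p $ 0 = 1"
  by (simp add: artin_hasse_def)

lemma fps_deriv_artin_hasse: "fps_deriv (artin_hasse p) = artin_hasse p * fps_deriv (AH_log p)"
  by (simp add: artin_hasse_def fps_compose_deriv AH_log_nth_0)

lemma X_mult_fps_deriv_AH_log:
  assumes "p > 0"
  shows "fps_X * fps_deriv (AH_log p) = Abs_fps (\<lambda>n. if \<exists>i. n = p ^ i then 1 else 0)"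
proof (rule fps_ext)
  fix n
  show "(fps_X * fps_deriv (AH_log p)) $ n = Abs_fps (\<lambda>n. if \<exists>i. n = p ^ i then 1 else 0) $ n"
    using assms by (cases n) (auto simp: AH_log_nth simp del: of_nat_Suc)
qed

lemma AH_log_compose_uminus:
  assumes "odd p"
  shows "AH_log p oo - fps_X = - AH_log p"
  by (rule fps_ext) (use assms in \<open>auto simp: fps_compose_uminus' AH_log_nth\<close>)

text \<open>Substituting \<open>X^p\<close> shifts the exponents: the term
  \<open>X^(p^(i+1)) / p^i\<close> is \<open>p\<close> times the term of index \<open>i + 1\<close>,
  and only the initial term \<open>X\<close> is lost.\<close>

lemma AH_log_compose_X_power:
  assumes "prime p"
  shows "AH_log p oo fps_X ^ p = of_nat p * (AH_log p - fps_X)"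
proof (rule fps_ext)
  fix n
  have p1: "p > 1" using assms prime_gt_1_nat by blast
  show "(AH_log p oo fps_X ^ p) $ n = (of_nat p * (AH_log p - fps_X)) $ n"
  proof (cases "\<exists>i. n = p ^ i")
    case True
    then obtain i where i: "n = p ^ i" by blast
    show ?thesis
    proof (cases i)
      case 0
      then show ?thesis using i p1
        by (auto simp: fps_nth_compose_X_power AH_log_nth fps_mult_of_nat_nth intro: exI[of _ 0])
    next
      case (Suc j)
      then have "n \<noteq> 1" "p dvd n" "n div p = p ^ j" using i p1 by auto
      then show ?thesis using i p1 Suc
        by (auto simp: fps_nth_compose_X_power AH_log_nth fps_X_nth fps_mult_of_nat_nth
            intro: exI[of _ "Suc j"])
    qed
  next
    case False
    then have "n \<noteq> 1" by (auto dest: spec[of _ 0])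
    moreover have "\<not> (\<exists>i. n div p = p ^ i)" if "p dvd n"
    proof
      assume "\<exists>i. n div p = p ^ i"
      then obtain i where "n div p = p ^ i" by blast
      then have "n = p ^ Suc i" using dvd_mult_div_cancel[OF that] by simp
      then show False using False by blast
    qed
    ultimately show ?thesis using False p1
      by (simp add: fps_nth_compose_X_power AH_log_nth fps_X_nth fps_mult_of_nat_nth)
  qed
qed

text \<open>For odd \<open>p\<close> the series \<open>AH_log p\<close> is odd, so its derivative is
  even and the chain rule changes only the sign.\<close>

lemma fps_deriv_artin_hasse_uminus:
  assumes "odd p"
  shows "fps_deriv (artin_hasse p oo - fps_X) = - (artin_hasse p oo - fps_X) * fps_deriv (AH_log p)"
proof -
  have "- fps_deriv (AH_log p) = fps_deriv (AH_log p oo - fps_X)"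
    by (simp add: AH_log_compose_uminus[OF assms])
  also have "\<dots> = - (fps_deriv (AH_log p) oo - fps_X)"
    by (subst fps_compose_deriv) simp_all
  finally have even: "fps_deriv (AH_log p) oo - fps_X = fps_deriv (AH_log p)" by simp
  have "fps_deriv (artin_hasse p oo - fps_X) = - (fps_deriv (artin_hasse p) oo - fps_X)"
    by (subst fps_compose_deriv) simp_all
  also have "fps_deriv (artin_hasse p) oo - fps_X = (artin_hasse p oo - fps_X) * fps_deriv (AH_log p)"
    unfolding fps_deriv_artin_hasse by (subst fps_compose_mult_distrib) (simp_all add: even)
  finally show ?thesis by simp
qed

lemma artin_hasse_mult_uminus:
  assumes "odd p"
  shows "artin_hasse p * (artin_hasse p oo - fps_X) = 1"
proof -
  let ?Q = "artin_hasse p * (artin_hasse p oo - fps_X)"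
  have "fps_deriv ?Q = 0"
    by (simp add: fps_deriv_artin_hasse fps_deriv_artin_hasse_uminus[OF assms] algebra_simps)
  then have "?Q = fps_const (?Q $ 0)" by (simp only: fps_deriv_eq_0_iff)
  then show ?thesis by (simp add: artin_hasse_nth_0)
qed

text \<open>Exponentiating \<open>p * AH_log = AH_log(X^p) + p * X\<close> gives the identity
  formally. The proof compares derivatives instead: the logarithmic derivatives of
  \<open>N ^ p\<close>, \<open>G\<close> and \<open>e\<close> are \<open>- p * l\<close>,
  \<open>p * (l - 1)\<close> and \<open>p\<close>, so their product is constant, and
  \<open>N\<close> is the inverse of the Artin-Hasse series.\<close>

lemma artin_hasse_power:
  assumes "prime p" "odd p"
  shows "artin_hasse p ^ p = (artin_hasse p oo fps_X ^ p) * fps_exp (of_nat p)"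
proof -
  have p0: "p > 0" using assms prime_gt_0_nat by blast
  define N where "N = artin_hasse p oo - fps_X"
  define G where "G = artin_hasse p oo fps_X ^ p"
  define e where "e = fps_exp (of_nat p :: rat)"
  define l where "l = fps_deriv (AH_log p)"
  have N': "fps_deriv N = - N * l"
    unfolding N_def l_def by (rule fps_deriv_artin_hasse_uminus[OF assms(2)])
  have e': "fps_deriv e = of_nat p * e"
    by (simp add: e_def fps_of_nat)
  have "fps_deriv G = G * ((l oo fps_X ^ p) * fps_deriv (fps_X ^ p))"
    unfolding G_def l_def using p0
    by (simp add: fps_compose_deriv fps_deriv_artin_hasse fps_compose_mult_distrib mult.assoc)
  also have "(l oo fps_X ^ p) * fps_deriv (fps_X ^ p) = fps_deriv (AH_log p oo fps_X ^ p)"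
    unfolding l_def using p0 by (simp add: fps_compose_deriv)
  also have "\<dots> = of_nat p * (l - 1)"
    unfolding AH_log_compose_X_power[OF assms(1)] l_def by simp
  finally have G': "fps_deriv G = G * (of_nat p * (l - 1))" .
  have Np: "fps_deriv (N ^ p) = - of_nat p * N ^ p * l"
  proof -
    have "fps_deriv (N ^ p) = of_nat p * fps_deriv N * N ^ (p - 1)"
      by (simp add: fps_deriv_power fps_of_nat)
    also have "\<dots> = - of_nat p * (N * N ^ (p - 1)) * l" by (simp add: N' algebra_simps)
    also have "N * N ^ (p - 1) = N ^ p" using p0 by (simp add: power_eq_if)
    finally show ?thesis .
  qed
  let ?Q = "N ^ p * G * e"
  have "fps_deriv ?Q = 0"
    by (simp add: Np G' e' algebra_simps)
  then have "?Q = fps_const (?Q $ 0)" by (simp only: fps_deriv_eq_0_iff)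
  then have Q1: "?Q = 1"
    by (simp add: N_def G_def e_def artin_hasse_nth_0 fps_power_zeroth)
  have "artin_hasse p ^ p = artin_hasse p ^ p * ?Q" unfolding Q1 by simp
  also have "\<dots> = (artin_hasse p * N) ^ p * (G * e)" by (simp only: power_mult_distrib mult_ac)
  also have "artin_hasse p * N = 1" unfolding N_def by (rule artin_hasse_mult_uminus[OF assms(2)])
  finally show ?thesis by (simp add: G_def e_def)
qed

text \<open>Up to \<open>X^n\<close> only the terms of degree at most one in \<open>k\<close>
  matter, and the linear one is \<open>m * g^(m-1) * X^n * k\<close>. This isolates the contribution
  of the \<open>n\<close>-th coefficient to a power of a series.\<close>

lemma fps_nth_power_add_X_power_mult:
  fixes g k :: "'a::comm_ring_1 fps"
  assumes "g $ 0 = 1" "n > 0"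
  shows "((g + fps_X ^ n * k) ^ m) $ n = (g ^ m) $ n + of_nat m * k $ 0"
proof -
  have "\<exists>r. (g + fps_X ^ n * k) ^ m = g ^ m + fps_X ^ n * r \<and> r $ 0 = of_nat m * k $ 0"
  proof (induction m)
    case (Suc m)
    then obtain r where r: "(g + fps_X ^ n * k) ^ m = g ^ m + fps_X ^ n * r" "r $ 0 = of_nat m * k $ 0"
      by blast
    have "(g + fps_X ^ n * k) ^ Suc m
        = g ^ Suc m + fps_X ^ n * (g * r + k * g ^ m + fps_X ^ n * k * r)"
      unfolding power_Suc r(1) by (simp add: algebra_simps)
    moreover have "(g * r + k * g ^ m + fps_X ^ n * k * r) $ 0 = of_nat (Suc m) * k $ 0"
      using assms by (simp add: r fps_power_zeroth power_0_left algebra_simps)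
    ultimately show ?case by blast
  qed (auto intro: exI[of _ 0])
  then show ?thesis by (auto simp: fps_X_power_mult_nth)
qed

text \<open>Dwork's argument: comparing the coefficients of \<open>X^n\<close> in \<open>AH(X)^p = AH(X^p) exp(pX)\<close>
  expresses \<open>p a\<^sub>n\<close> through earlier coefficients, and modulo \<open>p\<close> that expression vanishes because
  \<open>exp(pX) = 1\<close> and \<open>g(X)^p = g(X^p)\<close>.\<close>

lemma fps_p_integral_artin_hasse:
  assumes "odd CARD('p::prime_card)"
  shows "fps_p_integral CARD('p) (artin_hasse CARD('p))"
proof -
  let ?p = "CARD('p)"
  let ?f = "artin_hasse ?p"
  have pr: "prime ?p" by (rule prime_card)
  have p1: "?p > 1" using pr prime_gt_1_nat by blast
  have "p_integral ?p (?f $ n)" for n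
  proof (induction n rule: less_induct)
    case (less n)
    show ?case
    proof (cases "n = 0")
      case True
      then show ?thesis using p_integral_of_int[OF pr, of 1] by (simp add: artin_hasse_nth_0)
    next
      case False
      let ?g = "fps_cutoff n ?f"
      have int: "fps_p_integral ?p ?g"
        using less.IH p_integral_of_int[OF pr, of 0] by (auto simp: fps_p_integral_def)
      have "?f = ?g + fps_X ^ n * fps_shift n ?f"
        by (subst add.commute) (rule fps_shift_cutoff'[symmetric])
      then have "(?f ^ ?p) $ n = ((?g + fps_X ^ n * fps_shift n ?f) ^ ?p) $ n" by (rule arg_cong)
      also have "\<dots> = (?g ^ ?p) $ n + of_nat ?p * ?f $ n"
        using False by (subst fps_nth_power_add_X_power_mult) (simp_all add: artin_hasse_nth_0)
      also have "(?f ^ ?p) $ n = ((?f oo fps_X ^ ?p) * fps_exp (of_nat ?p)) $ n"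
        by (simp only: artin_hasse_power[OF pr assms])
      also have "\<dots> = ((?g oo fps_X ^ ?p) * fps_exp (of_nat ?p)) $ n"
        unfolding fps_mult_nth
      proof (intro sum.cong refl)
        \<comment> \<open>Since \<open>n > 0\<close> and \<open>p > 1\<close>, even
          \<open>i = n\<close> has \<open>i div p < n\<close>, so only coefficients covered by the
          induction hypothesis occur and \<open>?f\<close> may be replaced by its
          truncation.\<close>
        fix i assume "i \<in> {0..n}"
        then have "i div ?p < n"
          using False p1 by (cases "i = 0") (auto intro: less_le_trans[OF div_less_dividend])
        then show "(?f oo fps_X ^ ?p) $ i * fps_exp (of_nat ?p) $ (n - i)
          = (?g oo fps_X ^ ?p) $ i * fps_exp (of_nat ?p) $ (n - i)"
          by (simp add: fps_nth_compose_X_power)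
      qed
      finally have "((?g oo fps_X ^ ?p) * fps_exp (of_nat ?p)) $ n = (?g ^ ?p) $ n + of_nat ?p * ?f $ n" .
      \<comment> \<open>The difference is written as a sum with factor \<open>of_int (-1)\<close>,
        so that the rules for sums and products apply.\<close>
      then have eq: "of_nat ?p * ?f $ n
          = ((?g oo fps_X ^ ?p) * fps_exp (of_nat ?p)) $ n + of_int (-1) * (?g ^ ?p) $ n"
        by simp
      have i1: "fps_p_integral ?p ((?g oo fps_X ^ ?p) * fps_exp (of_nat ?p))"
        by (intro fps_p_integral_mult fps_p_integral_compose_X_power int fps_p_integral_exp_CARD) simp
      have i2: "fps_p_integral ?p (?g ^ ?p)" by (rule fps_p_integral_power[OF int])
      have i3: "p_integral ?p (of_int (-1) * (?g ^ ?p) $ n)"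
        using i2 p_integral_of_int[OF pr, of "-1"] unfolding fps_p_integral_def
        by (intro p_integral_mult) auto
      have "fps_red ((?g oo fps_X ^ ?p) * fps_exp (of_nat ?p)) = (fps_red (?g ^ ?p) :: 'p mod_ring fps)"
        by (simp add: fps_red_mult[OF fps_p_integral_compose_X_power[OF int] fps_p_integral_exp_CARD]
            fps_red_exp_CARD fps_red_compose_X_power[OF int] fps_red_power[OF int]
            fps_frobenius[of "fps_red ?g"])
      then have r: "red_mod (((?g oo fps_X ^ ?p) * fps_exp (of_nat ?p)) $ n) = (red_mod ((?g ^ ?p) $ n) :: 'p mod_ring)"
        by (simp add: fps_eq_iff)
      have "red_mod (of_int (-1) * (?g ^ ?p) $ n) = (of_int (-1) * red_mod ((?g ^ ?p) $ n) :: 'p mod_ring)"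
        using i2 p_integral_of_int[OF pr, of "-1"] unfolding fps_p_integral_def
        by (subst red_mod_mult) (auto simp del: of_int_minus of_int_1)
      then have "red_mod (of_nat ?p * ?f $ n) = (0 :: 'p mod_ring)"
        unfolding eq using i1 i3 r unfolding fps_p_integral_def by (subst red_mod_add) auto
      moreover have "p_integral ?p (of_nat ?p * ?f $ n)"
        unfolding eq using i1 i3 unfolding fps_p_integral_def by (intro p_integral_add) auto
      ultimately show ?thesis by (rule p_integral_if_red_mod_eq_0[rotated])
    qed
  qed
  then show ?thesis by (simp add: fps_p_integral_def)
qed

section \<open>The Artin-Hasse series modulo p\<close>

lemma E_p_eq_fps_red: "(E_p :: 'p::prime_card mod_ring fps) = fps_red (artin_hasse CARD('p))"
  by (simp add: E_p_def fps_red_def)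

lemma E_p_mult_uminus:
  assumes "odd CARD('p::prime_card)"
  shows "E_p * (E_p oo - fps_X) = (1 :: 'p mod_ring fps)"
proof -
  note int = fps_p_integral_artin_hasse[OF assms]
  have "fps_red (artin_hasse CARD('p) * (artin_hasse CARD('p) oo - fps_X)) = (1 :: 'p mod_ring fps)"
    unfolding artin_hasse_mult_uminus[OF assms] by simp
  then show ?thesis
    by (simp add: E_p_eq_fps_red fps_red_mult fps_p_integral_compose_uminus fps_red_compose_uminus int)
qed

text \<open>Over the rationals, \<open>X * AH' = t * AH\<close> where \<open>t\<close> is the sum of
  all \<open>X^(p^i)\<close>. Both factors on the right are \<open>p\<close>-integral, and
  \<open>t\<close> reduces to \<open>X + T\<close>, the term \<open>X\<close> coming from
  \<open>i = 0\<close>.\<close>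

lemma X_mult_fps_deriv_E_p:
  assumes "odd CARD('p::prime_card)"
  shows "fps_X * fps_deriv E_p = (fps_X + T_p) * (E_p :: 'p mod_ring fps)"
proof -
  let ?p = "CARD('p)"
  let ?f = "artin_hasse ?p"
  let ?t = "fps_X * fps_deriv (AH_log ?p)"
  note int = fps_p_integral_artin_hasse[OF assms]
  have pr: "prime ?p" by (rule prime_card)
  have p1: "?p > 1" using pr prime_gt_1_nat by blast
  have t: "?t = Abs_fps (\<lambda>n. if \<exists>i. n = ?p ^ i then 1 else 0)"
    by (rule X_mult_fps_deriv_AH_log) simp
  have int_t: "fps_p_integral ?p ?t"
    using p_integral_of_int[OF pr, of 0] p_integral_of_int[OF pr, of 1]
    unfolding t by (simp add: fps_p_integral_def)
  have red_t: "fps_red ?t = (fps_X + T_p :: 'p mod_ring fps)"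
  proof (rule fps_ext)
    fix n
    have "(\<exists>i. n = ?p ^ i) \<longleftrightarrow> n = 1 \<or> (\<exists>i\<ge>1. n = ?p ^ i)"
    proof
      assume "\<exists>i. n = ?p ^ i"
      then obtain i where "n = ?p ^ i" by blast
      then show "n = 1 \<or> (\<exists>i\<ge>1. n = ?p ^ i)" by (cases i) (auto intro: exI[of _ i])
    qed (auto intro: exI[of _ 0])
    moreover have "\<not> (\<exists>i\<ge>1. 1 = ?p ^ i)"
      using one_less_power[OF p1] by (metis less_irrefl not_one_le_zero neq0_conv)
    ultimately show "fps_red ?t $ n = (fps_X + T_p :: 'p mod_ring fps) $ n"
      unfolding t by (auto simp: T_p_def fps_X_nth)
  qed
  have "fps_X * fps_deriv E_p = (fps_red (fps_X * fps_deriv ?f) :: 'p mod_ring fps)"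
  proof (rule fps_ext)
    fix n
    have "red_mod (of_nat m * ?f $ m) = (of_nat m * red_mod (?f $ m) :: 'p mod_ring)" for m
      using int p_integral_of_int[OF pr, of "int m"]
      by (subst red_mod_mult) (simp_all add: fps_p_integral_def)
    then show "(fps_X * fps_deriv E_p) $ n = (fps_red (fps_X * fps_deriv ?f) :: 'p mod_ring fps) $ n"
      by (cases n) (simp_all add: E_p_eq_fps_red del: of_nat_Suc)
  qed
  also have "fps_X * fps_deriv ?f = ?t * ?f"
    by (simp add: fps_deriv_artin_hasse mult_ac)
  also have "fps_red (?t * ?f) = (fps_X + T_p) * (E_p :: 'p mod_ring fps)"
    by (subst fps_red_mult) (simp_all only: int_t int red_t E_p_eq_fps_red)
  finally show ?thesis .
qed

subsection \<open>Series in \<open>X^p\<close> and the Laguerre polynomial\<close>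

definition fps_multiples :: "nat \<Rightarrow> 'a::zero fps \<Rightarrow> 'a fps" where
  "fps_multiples p f = Abs_fps (\<lambda>n. if p dvd n then f $ n else 0)"

lemma fps_multiples_nth [simp]: "fps_multiples p f $ n = (if p dvd n then f $ n else 0)"
  by (simp add: fps_multiples_def)

lemma fps_multiples_sum: "fps_multiples p (sum f I) = (\<Sum>i\<in>I. fps_multiples p (f i))"
  by (rule fps_ext) (simp add: fps_sum_nth)

lemma fps_multiples_X_power: "fps_multiples p (fps_X ^ k) = (if p dvd k then fps_X ^ k else 0)"
  by (rule fps_ext) auto

text \<open>Extraction of the exponents divisible by \<open>p\<close> is linear over series in
  \<open>X^p\<close>: multiplying by such a series preserves residue classes of exponents.\<close>

lemma fps_multiples_mult:
  fixes c f :: "'a::comm_ring_1 fps"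
  assumes "fps_multiples p c = c"
  shows "fps_multiples p (c * f) = c * fps_multiples p f"
proof (rule fps_ext)
  fix n
  have *: "c $ i * fps_multiples p f $ (n - i) = (if p dvd n then c $ i * f $ (n - i) else 0)"
    if "i \<le> n" for i
  proof (cases "p dvd i")
    case True
    then have "p dvd n - i \<longleftrightarrow> p dvd n" using that by (auto intro: dvd_diffD)
    then show ?thesis by simp
  next
    case False
    then have "c $ i = 0" using fps_multiples_nth[of p c i] by (simp add: assms)
    then show ?thesis by simp
  qed
  show "fps_multiples p (c * f) $ n = (c * fps_multiples p f) $ n"
    unfolding fps_mult_nth fps_multiples_nth[of p "c * f"] by (simp add: * del: fps_multiples_nth)
qed

text \<open>A zero derivative says \<open>n * f_n = 0\<close> for all \<open>n\<close>, and
  \<open>n\<close> is invertible in the field unless \<open>p\<close> divides it. Being a series in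
  \<open>X^p\<close> can thus be checked by the rules of differentiation.\<close>

lemma fps_multiples_CARD_iff:
  fixes f :: "'p::prime_card mod_ring fps"
  shows "fps_multiples CARD('p) f = f \<longleftrightarrow> fps_deriv f = 0"
proof -
  have of_nat_0: "of_nat n = (0 :: 'p mod_ring) \<longleftrightarrow> CARD('p) dvd n" for n
    using of_nat_eq_0_iff_char_dvd[where 'a = "'p mod_ring"] by simp
  have "fps_deriv f = 0 \<longleftrightarrow> (\<forall>n. of_nat (Suc n) * f $ Suc n = 0)"
    by (simp add: fps_eq_iff del: of_nat_Suc)
  also have "\<dots> \<longleftrightarrow> (\<forall>n. of_nat n * f $ n = 0)"
  proof
    assume *: "\<forall>n. of_nat (Suc n) * f $ Suc n = 0"
    have "of_nat n * f $ n = 0" for n using * by (cases n) (simp_all del: of_nat_Suc)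
    then show "\<forall>n. of_nat n * f $ n = 0" by blast
  qed blast
  also have "\<dots> \<longleftrightarrow> fps_multiples CARD('p) f = f"
    by (auto simp: fps_eq_iff of_nat_0)
  finally show ?thesis by simp
qed

section \<open>Properties of the series T\<close>

lemma of_nat_CARD_fps: "of_nat CARD('p) = (0 :: 'p::prime_card mod_ring fps)"
  by (simp flip: fps_of_nat)

text \<open>By Frobenius, \<open>T^p\<close> is \<open>T(X^p)\<close>, that is, \<open>T\<close>
  without its first term \<open>X^p\<close>.\<close>

lemma T_p_minus_power: "T_p - T_p ^ CARD('p) = (fps_X ^ CARD('p) :: 'p::prime_card mod_ring fps)"
proof (rule fps_ext)
  fix n
  let ?p = "CARD('p)"
  have p1: "?p > 1" by (rule nontriv)
  have "(\<exists>i\<ge>1. n = ?p ^ i) \<longleftrightarrow> n = ?p \<or> (?p dvd n \<and> (\<exists>i\<ge>1. n div ?p = ?p ^ i))"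
  proof
    assume "\<exists>i\<ge>1. n = ?p ^ i"
    then obtain i where i: "i \<ge> 1" "n = ?p ^ i" by blast
    then obtain j where j: "i = Suc j" by (cases i) auto
    show "n = ?p \<or> (?p dvd n \<and> (\<exists>i\<ge>1. n div ?p = ?p ^ i))"
      using i j p1 by (cases j) (auto intro: exI[of _ j])
  next
    assume "n = ?p \<or> (?p dvd n \<and> (\<exists>i\<ge>1. n div ?p = ?p ^ i))"
    then show "\<exists>i\<ge>1. n = ?p ^ i"
    proof
      assume "?p dvd n \<and> (\<exists>i\<ge>1. n div ?p = ?p ^ i)"
      then obtain i where i: "?p dvd n" "n div ?p = ?p ^ i" by blast
      then have "n = ?p ^ Suc i" using dvd_mult_div_cancel[OF i(1)] by simp
      then show ?thesis by (intro exI[of _ "Suc i"]) auto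
    qed (auto intro: exI[of _ 1])
  qed
  moreover have "\<not> (\<exists>i\<ge>1. 1 = ?p ^ i)"
    using one_less_power[OF p1] by (metis less_irrefl not_one_le_zero neq0_conv)
  ultimately show "(T_p - T_p ^ ?p) $ n = (fps_X ^ ?p :: 'p mod_ring fps) $ n"
    unfolding fps_frobenius[of T_p] using p1
    by (auto simp: fps_nth_compose_X_power T_p_def)
qed

lemma fps_deriv_T_p: "fps_deriv T_p = (0 :: 'p::prime_card mod_ring fps)"
  unfolding fps_multiples_CARD_iff[symmetric]
  by (rule fps_ext) (auto simp: T_p_def Suc_le_eq dvd_power)

lemma T_p_compose_uminus:
  assumes "odd CARD('p::prime_card)"
  shows "T_p oo - fps_X = (- T_p :: 'p mod_ring fps)"
  by (rule fps_ext) (use assms in \<open>auto simp: fps_compose_uminus' T_p_def\<close>)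

lemma fps_deriv_pochhammer:
  fixes x :: "'a::comm_ring_1 fps"
  assumes "fps_deriv x = 0"
  shows "fps_deriv (pochhammer x m) = 0"
  by (induction m) (simp_all add: pochhammer_Suc assms)

lemma pochhammer_compose_uminus:
  fixes x :: "'a::idom fps"
  shows "pochhammer x m oo - fps_X = pochhammer (x oo - fps_X) m"
  by (induction m) (simp_all add: pochhammer_Suc fps_compose_mult_distrib fps_compose_add_distrib flip: fps_of_nat)

section \<open>The Laguerre polynomial in terms of Pochhammer symbols\<close>

lemma of_nat_fact_CARD_minus_1: "of_nat (fact (CARD('p) - 1)) = (- 1 :: 'p::prime_card mod_ring)"
proof -
  have "[fact (CARD('p) - 1) = - 1] (mod int CARD('p))"
    by (rule wilson_theorem[OF prime_card])
  then have "of_int (int (fact (CARD('p) - 1))) = (of_int (- 1) :: 'p mod_ring)"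
    by (simp only: of_int_eq_iff_cong_CHAR semiring_char_mod_ring of_nat_fact)
  then show ?thesis by (simp only: of_int_of_nat_eq of_int_minus of_int_1)
qed

text \<open>Up to sign this is the Laguerre polynomial at the parameter \<open>- T\<close>, with the factorials
  eliminated through \<open>k! (p - 1 - k)! = - (-1)^k\<close> in characteristic \<open>p\<close>.\<close>

definition laguerre_poch :: "'p::prime_card mod_ring fps \<Rightarrow> 'p mod_ring fps" where
  "laguerre_poch T = (\<Sum>k\<le>CARD('p) - 1. (- 1) ^ k * pochhammer (T + 1) (CARD('p) - 1 - k) * fps_X ^ k)"

lemma laguerre_p_uminus_eq:
  fixes T :: "'p::prime_card mod_ring fps"
  assumes "odd CARD('p)"
  shows "laguerre_p (- T) = - laguerre_poch T"
  unfolding laguerre_p_def laguerre_poch_def sum_negf[symmetric]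
proof (intro sum.cong refl)
  fix k assume "k \<in> {..CARD('p) - 1}"
  then have k: "k \<le> CARD('p) - 1" by simp
  let ?n = "CARD('p) - 1"
  let ?m = "?n - k"
  let ?a = "of_nat (fact ?m) :: 'p mod_ring" and ?b = "of_nat (fact k) :: 'p mod_ring"
  have pr: "prime CHAR('p mod_ring)" by (simp add: prime_card)
  have p1: "CARD('p) > 1" by (rule nontriv)
  have "of_nat (fact k * fact ?m * (?n choose k)) = (of_nat (fact ?n) :: 'p mod_ring)"
    using binomial_fact_lemma[OF k] by simp
  moreover have "of_nat (?n choose k) = ((- 1) ^ k :: 'p mod_ring)"
    using of_nat_binomial_CHAR_minus_1[OF pr, of k] k p1 by simp
  ultimately have "?b * ?a * (- 1) ^ k = - 1"
    unfolding of_nat_fact_CARD_minus_1 of_nat_mult by simp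
  then have "?a * ?b = - ((- 1) ^ k)"
    by (cases "even k") (simp_all add: mult.commute)
  then have inv: "inverse ?a * inverse ?b = - ((- 1) ^ k)"
    by (simp add: nonzero_inverse_minus_eq flip: inverse_mult_distrib power_inverse)
  \<comment> \<open>Pulling out the signs leaves \<open>(-1)^m\<close> here and
    \<open>(-1)^k\<close> from \<open>(- X)^k\<close>; together they give
    \<open>(-1)^(p-1) = 1\<close> for odd \<open>p\<close>.\<close>
  have "(\<Prod>j<?m. - T - 1 - of_nat j) = (\<Prod>j<?m. (- 1) * (T + 1 + of_nat j))"
    by (intro prod.cong) simp_all
  also have "\<dots> = (- 1) ^ ?m * pochhammer (T + 1) ?m"
    unfolding prod.distrib by (simp add: pochhammer_prod atLeast0LessThan)
  finally have "binom_fps (- T - 1) ?m * (- fps_X) ^ k * fps_const (inverse ?b)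
      = fps_const (inverse ?a * inverse ?b) * ((- 1) ^ ?m * (- 1) ^ k) * pochhammer (T + 1) ?m * fps_X ^ k"
    unfolding binom_fps_def by (subst power_minus) (simp add: mult_ac flip: fps_const_mult)
  also have "(- 1) ^ ?m * (- 1) ^ k = (1 :: 'p mod_ring fps)"
    unfolding power_add[symmetric] le_add_diff_inverse2[OF k] using assms by simp
  finally show "binom_fps (- T - 1) ?m * (- fps_X) ^ k * fps_const (inverse ?b)
      = - ((- 1) ^ k * pochhammer (T + 1) ?m * fps_X ^ k)"
    unfolding inv by (simp flip: fps_const_neg fps_const_power)
qed

section \<open>The differential equation and the X^p-parts of the Laguerre polynomial\<close>

context
  fixes T :: "'p::prime_card mod_ring fps" and n :: nat
  assumes odd: "odd CARD('p)" and deriv_T: "fps_deriv T = 0"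
    and T_power: "T - T ^ CARD('p) = fps_X ^ CARD('p)"
  defines "n \<equiv> CARD('p) - 1"
begin

lemma CARD_eq_Suc: "CARD('p) = Suc n"
  using nontriv[where 'a = 'p] by (simp add: n_def)

lemma even_n: "even n"
  using odd CARD_eq_Suc by simp

lemma of_nat_n: "of_nat n = (- 1 :: 'p mod_ring fps)"
  using of_nat_CARD_fps[where 'p = 'p] unfolding CARD_eq_Suc by (simp add: eq_neg_iff_add_eq_0 add.commute)

lemma pochhammer_CARD: "pochhammer x (Suc n) = x ^ CARD('p) - (x :: 'p mod_ring fps)"
  using pochhammer_CHAR[of x] by (simp add: prime_card flip: CARD_eq_Suc)

text \<open>The factor \<open>T\<close> completes the symbol to \<open>pochhammer T p\<close>, which
  is \<open>T^p - T\<close>.\<close>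

lemma T_mult_pochhammer: "T * pochhammer (T + 1) n = - (fps_X ^ CARD('p))"
  using pochhammer_CARD[of T] unfolding pochhammer_rec T_power[symmetric] by simp

lemma T_nonzero: "T \<noteq> 0"
  using T_mult_pochhammer by auto

lemma T_mult_pochhammer_minus: "T * pochhammer (1 - T) n = - (fps_X ^ CARD('p))"
  using pochhammer_CARD[of "- T"] odd unfolding pochhammer_rec T_power[symmetric]
  by (simp add: algebra_simps)

text \<open>Both sides become \<open>- X^p\<close> after multiplication by the nonzero
  \<open>T\<close>; their common value is \<open>T^(p-1) - 1\<close>.\<close>

lemma pochhammer_minus_eq: "pochhammer (1 - T) n = pochhammer (T + 1) n"
  using T_mult_pochhammer T_mult_pochhammer_minus T_nonzero by (metis mult_left_cancel)

text \<open>The coefficients \<open>g k\<close> have derivative 0, so the difference of the two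
  sides is a sum of \<open>G k - g k * X^(k+1)\<close>. The recurrence
  \<open>g k = (k + 1 - T) * g (k + 1)\<close> makes it telescope, and the two boundary terms
  \<open>G 0\<close> and \<open>X^p\<close> are equal.\<close>

lemma X_mult_fps_deriv_laguerre_poch:
  "fps_X * fps_deriv (laguerre_poch T) = (fps_X + T) * laguerre_poch T"
proof -
  define g where "g k = (- 1) ^ k * pochhammer (T + 1) (n - k)" for k
  define G where "G k = (of_nat k - T) * g k * fps_X ^ k" for k
  have L: "laguerre_poch T = (\<Sum>k\<le>n. g k * fps_X ^ k)"
    by (simp add: laguerre_poch_def g_def n_def)
  have g': "fps_deriv (g k) = 0" for k
  proof -
    have "fps_deriv ((- 1) ^ k :: 'p mod_ring fps) = 0" by (cases "even k") simp_all
    then show ?thesis by (simp add: g_def fps_deriv_pochhammer deriv_T)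
  qed
  have step: "g k = (of_nat (Suc k) - T) * g (Suc k)" if "k < n" for k
  proof -
    have s: "n - k = Suc (n - Suc k)" using that by simp
    \<comment> \<open>In characteristic \<open>p\<close> the number \<open>n = p - 1\<close> is
      \<open>-1\<close>, which turns the last Pochhammer factor into
      \<open>T - (k + 1)\<close>.\<close>
    have "of_nat (n - Suc k) = (- 1 - of_nat (Suc k) :: 'p mod_ring fps)"
      using that by (simp only: of_nat_diff Suc_leI of_nat_n)
    then have "T + 1 + of_nat (n - Suc k) = - (of_nat (Suc k) - T)" by simp
    then have "g k = (- 1) ^ k * (pochhammer (T + 1) (n - Suc k) * - (of_nat (Suc k) - T))"
      unfolding g_def s pochhammer_Suc by (rule arg_cong)
    then show ?thesis unfolding g_def by (simp only: power_Suc mult_ac mult_minus_left mult_minus_right mult_1)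
  qed
  have summand: "fps_X * fps_deriv (g k * fps_X ^ k) - (fps_X + T) * (g k * fps_X ^ k)
      = G k - g k * fps_X ^ Suc k" for k
  proof -
    have "fps_X * fps_deriv (fps_X ^ k) = of_nat k * (fps_X ^ k :: 'p mod_ring fps)"
    proof (rule fps_ext)
      fix i
      show "(fps_X * fps_deriv (fps_X ^ k)) $ i = (of_nat k * (fps_X ^ k :: 'p mod_ring fps)) $ i"
        by (cases i) (auto simp: fps_mult_of_nat_nth simp del: of_nat_Suc)
    qed
    moreover have "fps_X * fps_deriv (g k * fps_X ^ k) = g k * (fps_X * fps_deriv (fps_X ^ k))"
      by (simp add: g' mult_ac)
    ultimately show ?thesis by (simp add: G_def algebra_simps)
  qed
  have "fps_X * fps_deriv (laguerre_poch T) - (fps_X + T) * laguerre_poch T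
      = (\<Sum>k\<le>n. G k - g k * fps_X ^ Suc k)"
    unfolding L fps_deriv_sum sum_distrib_left sum_subtractf[symmetric] summand ..
  also have "\<dots> = (\<Sum>k<n. G k - G (Suc k)) + (G n - g n * fps_X ^ Suc n)"
    unfolding lessThan_Suc_atMost[symmetric] sum.lessThan_Suc
    by (intro arg_cong2[where f = "(+)"] sum.cong refl) (simp add: G_def step)
  also have "\<dots> = G 0 - fps_X ^ CARD('p)"
    unfolding sum_lessThan_telescope' using even_n by (simp add: g_def CARD_eq_Suc)
  also have "\<dots> = 0"
    using T_mult_pochhammer by (simp add: G_def g_def)
  finally show ?thesis by simp
qed

text \<open>The coefficients are series in \<open>X^p\<close>, and among the exponents
  \<open>0, ..., p - 1\<close> of the explicit powers only 0 is divisible by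
  \<open>p\<close>.\<close>

lemma fps_multiples_laguerre_poch: "fps_multiples CARD('p) (laguerre_poch T) = pochhammer (T + 1) n"
proof -
  have "fps_multiples CARD('p) ((- 1) ^ k * pochhammer (T + 1) (n - k) * fps_X ^ k)
      = (if k = 0 then pochhammer (T + 1) n else 0)" if "k \<le> n" for k
  proof -
    have "fps_deriv ((- 1) ^ k :: 'p mod_ring fps) = 0" by (cases "even k") simp_all
    then have "fps_deriv ((- 1) ^ k * pochhammer (T + 1) (n - k)) = 0"
      by (simp add: fps_deriv_pochhammer deriv_T)
    then have "fps_multiples CARD('p) ((- 1) ^ k * pochhammer (T + 1) (n - k) * fps_X ^ k)
        = (- 1) ^ k * pochhammer (T + 1) (n - k) * fps_multiples CARD('p) (fps_X ^ k)"
      by (intro fps_multiples_mult) (simp only: fps_multiples_CARD_iff)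
    moreover have "CARD('p) dvd k \<longleftrightarrow> k = 0"
      using that by (auto simp: CARD_eq_Suc dest: dvd_imp_le)
    ultimately show ?thesis by (simp add: fps_multiples_X_power)
  qed
  then show ?thesis
    unfolding laguerre_poch_def fps_multiples_sum n_def[symmetric] by simp
qed

text \<open>The mixed terms of the product, after multiplication by \<open>T\<close>, form the Chu--Vandermonde sum
  for \<open>pochhammer (- T + (T + 1)) (p - 1)\<close>, whose binomial coefficients are \<open>(-1)^k\<close> modulo \<open>p\<close>.\<close>

lemma fps_multiples_laguerre_poch_mult:
  "fps_multiples CARD('p) (laguerre_poch T * (\<Sum>j\<le>n. pochhammer (1 - T) (n - j) * fps_X ^ j))
    = - pochhammer (T + 1) n"
proof -
  let ?p = "CARD('p)"
  define g where "g k = (- 1) ^ k * pochhammer (T + 1) (n - k)" for k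
  define h where "h j = pochhammer (1 - T) (n - j)" for j
  define M where "M = (\<Sum>j\<le>n. h j * fps_X ^ j)"
  have g': "fps_deriv (g k) = 0" for k
  proof -
    have "fps_deriv ((- 1) ^ k :: 'p mod_ring fps) = 0" by (cases "even k") simp_all
    then show ?thesis by (simp add: g_def fps_deriv_pochhammer deriv_T)
  qed
  have h': "fps_deriv (h j) = 0" for j
    by (simp add: h_def fps_deriv_pochhammer deriv_T)
  \<comment> \<open>As \<open>k\<close> and \<open>j\<close> are below \<open>p\<close>, the
    exponent \<open>k + j\<close> is a multiple of \<open>p\<close> only for
    \<open>k = j = 0\<close> or \<open>k + j = p\<close>, so each \<open>k\<close> has a single
    partner \<open>j\<close>.\<close>
  have MX: "fps_multiples ?p (fps_X ^ k * M) = (if k = 0 then h 0 else h (?p - k) * fps_X ^ ?p)"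
    if k: "k \<le> n" for k
  proof -
    have "fps_multiples ?p (fps_X ^ k * M) = (\<Sum>j\<le>n. fps_multiples ?p (h j * fps_X ^ (k + j)))"
      by (simp add: M_def sum_distrib_left fps_multiples_sum power_add mult_ac)
    also have "\<dots> = (\<Sum>j\<le>n. if ?p dvd k + j then h j * fps_X ^ (k + j) else 0)"
      by (intro sum.cong refl)
        (simp add: fps_multiples_mult fps_multiples_CARD_iff h' fps_multiples_X_power)
    also have "\<dots> = (\<Sum>j\<le>n. if j = (if k = 0 then 0 else ?p - k) then h j * fps_X ^ (k + j) else 0)"
    proof (intro sum.cong refl if_cong)
      fix j assume "j \<in> {..n}"
      then have j: "j < ?p" and k': "k < ?p" using k by (simp_all add: CARD_eq_Suc)
      have "?p dvd k + j \<longleftrightarrow> k + j = 0 \<or> k + j = ?p"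
      proof
        assume "?p dvd k + j"
        then obtain q where q: "k + j = ?p * q" by blast
        then have "?p * q < ?p * 2" using j k' by linarith
        then have "q < 2" using mult_less_cancel1 by blast
        then show "k + j = 0 \<or> k + j = ?p" using q by (cases q) auto
      qed auto
      then show "?p dvd k + j \<longleftrightarrow> j = (if k = 0 then 0 else ?p - k)" using j k' by auto
    qed
    also have "\<dots> = (if k = 0 then h 0 else h (?p - k) * fps_X ^ ?p)"
      using k by (auto simp: CARD_eq_Suc simp del: power_Suc)
    finally show ?thesis .
  qed
  have "fps_multiples ?p (laguerre_poch T * M) = (\<Sum>k\<le>n. g k * fps_multiples ?p (fps_X ^ k * M))"
    unfolding laguerre_poch_def n_def[symmetric] g_def[symmetric]
    by (simp add: sum_distrib_right fps_multiples_sum mult.assoc fps_multiples_mult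
      fps_multiples_CARD_iff g')
  also have "\<dots> = (\<Sum>k\<le>n. if k = 0 then g 0 * h 0 else g k * h (?p - k) * fps_X ^ ?p)"
    by (intro sum.cong refl) (simp add: MX mult.assoc)
  also have "\<dots> = g 0 * h 0 + (\<Sum>k\<in>{..n} - {0}. g k * h (?p - k)) * fps_X ^ ?p"
    by (subst sum.remove[of _ 0]) (simp_all add: sum_distrib_right)
  finally have main: "fps_multiples ?p (laguerre_poch T * M)
      = g 0 * h 0 + (\<Sum>k\<in>{..n} - {0}. g k * h (?p - k)) * fps_X ^ ?p" .
  \<comment> \<open>Here \<open>T\<close> supplies the missing first factor:
    \<open>T * pochhammer (1 - T) (k - 1)\<close> is \<open>- pochhammer (- T) k\<close>.\<close>
  have "T * (\<Sum>k\<in>{..n} - {0}. g k * h (?p - k))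
      = - (\<Sum>k\<in>{..n} - {0}. of_nat (n choose k) * pochhammer (- T) k * pochhammer (T + 1) (n - k))"
    unfolding sum_distrib_left sum_negf[symmetric]
  proof (intro sum.cong refl)
    fix k assume k: "k \<in> {..n} - {0}"
    then obtain i where i: "k = Suc i" by (cases k) auto
    have "of_nat (n choose k) = ((- 1) ^ k :: 'p mod_ring fps)"
      using of_nat_binomial_CHAR_minus_1[where 'a = "'p mod_ring fps", of k]
        prime_card[where 'a = 'p] k
      by (simp add: CARD_eq_Suc)
    moreover have "h (?p - k) = pochhammer (1 - T) i"
      using k i by (simp add: h_def CARD_eq_Suc)
    moreover have "pochhammer (- T) k = - T * pochhammer (1 - T) i"
      by (simp add: i pochhammer_rec)
    ultimately show "T * (g k * h (?p - k))
        = - (of_nat (n choose k) * pochhammer (- T) k * pochhammer (T + 1) (n - k))"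
      by (simp add: g_def mult_ac)
  qed
  also have "(\<Sum>k\<in>{..n} - {0}. of_nat (n choose k) * pochhammer (- T) k * pochhammer (T + 1) (n - k))
      = pochhammer 1 n - pochhammer (T + 1) n"
    using pochhammer_binomial_sum[of "- T" "T + 1" n] by (simp add: sum.remove[of "{..n}" 0])
  also have "pochhammer 1 n = (- 1 :: 'p mod_ring fps)"
  proof -
    have "pochhammer 1 n = (of_nat (fact n) :: 'p mod_ring fps)"
      using pochhammer_of_nat[of 1 n, where 'a = "'p mod_ring fps"] by (simp add: pochhammer_fact)
    also have "\<dots> = fps_const (of_nat (fact n))" by (simp only: fps_of_nat)
    also have "\<dots> = - 1" unfolding n_def of_nat_fact_CARD_minus_1 by (simp flip: fps_const_neg)
    finally show ?thesis .
  qed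
  finally have sum: "T * (\<Sum>k\<in>{..n} - {0}. g k * h (?p - k)) = 1 + pochhammer (T + 1) n" by simp
  \<comment> \<open>The term \<open>k = 0\<close> gives \<open>- X^p * pochhammer (T + 1) n\<close>,
    which cancels against the mixed terms and leaves \<open>X^p\<close>, again a multiple of
    \<open>T\<close>.\<close>
  have "T * fps_multiples ?p (laguerre_poch T * M)
      = (T * pochhammer (T + 1) n) * pochhammer (T + 1) n
        + (T * (\<Sum>k\<in>{..n} - {0}. g k * h (?p - k))) * fps_X ^ ?p"
    unfolding main by (simp add: g_def h_def pochhammer_minus_eq algebra_simps)
  also have "\<dots> = T * (- pochhammer (T + 1) n)"
    unfolding sum mult_minus_right T_mult_pochhammer by (simp add: algebra_simps)
  finally have "fps_multiples ?p (laguerre_poch T * M) = - pochhammer (T + 1) n"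
    using T_nonzero mult_left_cancel by blast
  then show ?thesis by (simp add: M_def h_def)
qed

lemma laguerre_poch_compose_uminus:
  assumes "T oo - fps_X = - T"
  shows "laguerre_poch T oo - fps_X = (\<Sum>j\<le>n. pochhammer (1 - T) (n - j) * fps_X ^ j)"
  unfolding laguerre_poch_def n_def[symmetric] fps_compose_sum_distrib
proof (intro sum.cong refl)
  fix k
  have "(- 1) ^ k * fps_X ^ k oo - fps_X = (fps_X ^ k :: 'p mod_ring fps)"
    by (rule fps_ext) (cases "even k"; simp add: fps_compose_uminus')
  then have "pochhammer (T + 1) (n - k) * ((- 1) ^ k * fps_X ^ k) oo - fps_X
      = pochhammer (1 - T) (n - k) * fps_X ^ k"
    by (subst fps_compose_mult_distrib)
      (simp_all add: pochhammer_compose_uminus fps_compose_add_distrib assms)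
  then show "(- 1) ^ k * pochhammer (T + 1) (n - k) * fps_X ^ k oo - fps_X
      = pochhammer (1 - T) (n - k) * fps_X ^ k"
    by (simp only: mult_ac)
qed

end

section \<open>Derivation of the two identities\<close>

lemma fps_compose_uminus_uminus: "(f oo - fps_X) oo - fps_X = (f :: 'a::comm_ring_1 fps)"
  by (rule fps_ext) (simp add: fps_compose_uminus' flip: mult.assoc power_add)

theorem theorem1p1:
  assumes "odd CARD('p::prime_card)"
  shows "laguerre_p (- (T_p :: 'p mod_ring fps)) =
           E_p * Abs_fps (\<lambda>m. if CARD('p) dvd m then (-1) ^ (m div CARD('p)) * (fps_nth E_p m) else 0)
       \<and> laguerre_p (- (T_p :: 'p mod_ring fps)) * T_p *
           Abs_fps (\<lambda>m. if CARD('p) dvd m then fps_nth E_p m else 0) = fps_X ^ CARD('p) * E_p"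
proof -
  let ?p = "CARD('p)"
  let ?T = "T_p :: 'p mod_ring fps"
  define E where "E = (E_p :: 'p mod_ring fps)"
  define A where "A = fps_multiples ?p E"
  define L where "L = laguerre_poch ?T"
  define N where "N = E oo - fps_X"
  define S where "S = - L * N"
  \<comment> \<open>This is \<open>1 - T^(p-1)\<close>, kept in Pochhammer form because both
    evaluations below produce it so.\<close>
  define c where "c = - pochhammer (?T + 1) (?p - 1)"
  note ctxt = assms fps_deriv_T_p T_p_minus_power
  have laguerre: "laguerre_p (- ?T) = - L"
    unfolding L_def by (rule laguerre_p_uminus_eq[OF assms])
  have EN: "E * N = 1" unfolding E_def N_def by (rule E_p_mult_uminus[OF assms])
  have Tc: "?T * c = fps_X ^ ?p"
    using T_mult_pochhammer[OF ctxt] by (simp add: c_def)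
  have dE: "fps_X * fps_deriv E = (fps_X + ?T) * E"
    unfolding E_def by (rule X_mult_fps_deriv_E_p[OF assms])
  have dL: "fps_X * fps_deriv L = (fps_X + ?T) * L"
    unfolding L_def by (rule X_mult_fps_deriv_laguerre_poch[OF ctxt])
  have "fps_X * fps_deriv N = (fps_X * fps_deriv E) oo - fps_X"
    unfolding N_def by (simp add: fps_compose_deriv fps_compose_mult_distrib)
  also have "\<dots> = - (fps_X + ?T) * N"
    unfolding dE N_def
    by (simp add: fps_compose_mult_distrib fps_compose_add_distrib T_p_compose_uminus[OF assms])
  finally have dN: "fps_X * fps_deriv N = - (fps_X + ?T) * N" .
  have "fps_X * fps_deriv S = - ((fps_X * fps_deriv L) * N + L * (fps_X * fps_deriv N))"
    by (simp add: S_def algebra_simps)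
  also have "\<dots> = 0" unfolding dL dN by (simp add: algebra_simps)
  finally have dS: "fps_deriv S = 0" by simp
  have LS: "- L = E * S"
  proof -
    have "E * S = - L * (E * N)" by (simp add: S_def mult_ac)
    then show ?thesis by (simp add: EN)
  qed
  have SA: "S * A = c"
  proof -
    have "c = fps_multiples ?p (- L)"
      using fps_multiples_laguerre_poch[OF ctxt] fps_multiples_mult[of ?p "- 1" L]
      by (simp add: c_def L_def fps_multiples_CARD_iff)
    also have "\<dots> = S * A"
      unfolding LS A_def mult.commute[of E] using dS
      by (intro fps_multiples_mult) (simp only: fps_multiples_CARD_iff)
    finally show ?thesis by simp
  qed
  have S_uminus: "S oo - fps_X = A"
  proof -
    have "S oo - fps_X = - (L oo - fps_X) * E"
      unfolding S_def N_def
      by (simp add: fps_compose_mult_distrib fps_compose_uminus fps_compose_uminus_uminus)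
    then have "S * (S oo - fps_X) = L * (L oo - fps_X) * (E * N)"
      by (simp add: S_def mult_ac)
    then have prod: "S * (S oo - fps_X) = L * (L oo - fps_X)" by (simp add: EN)
    have "fps_deriv (S oo - fps_X) = 0" by (simp add: fps_compose_deriv dS)
    then have "fps_deriv (S * (S oo - fps_X)) = 0" by (simp add: dS)
    then have "S * (S oo - fps_X) = fps_multiples ?p (L * (L oo - fps_X))"
      unfolding prod by (rule fps_multiples_CARD_iff[THEN iffD2, symmetric])
    also have "\<dots> = c"
      unfolding L_def laguerre_poch_compose_uminus[OF ctxt T_p_compose_uminus[OF assms]] c_def
      by (rule fps_multiples_laguerre_poch_mult[OF ctxt])
    finally have "S * (S oo - fps_X) = S * A" by (simp add: SA)
    \<comment> \<open>If \<open>S\<close> were 0 then \<open>c\<close> would be 0, against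
      \<open>T * c = X^p\<close>; so \<open>S\<close> cancels in the domain of power series.\<close>
    moreover have "S \<noteq> 0" using SA Tc by auto
    ultimately show ?thesis by simp
  qed
  have "S = A oo - fps_X"
    unfolding S_uminus[symmetric] by (rule fps_compose_uminus_uminus[symmetric])
  \<comment> \<open>For \<open>m = p * q\<close> with \<open>p\<close> odd, the sign
    \<open>(-1)^m\<close> of the substitution is \<open>(-1)^q\<close>.\<close>
  also have "\<dots> = Abs_fps (\<lambda>m. if ?p dvd m then (-1) ^ (m div ?p) * (E $ m) else 0)"
    using assms by (intro fps_ext) (auto simp: fps_compose_uminus' A_def power_mult)
  finally have S: "S = Abs_fps (\<lambda>m. if ?p dvd m then (-1) ^ (m div ?p) * (E $ m) else 0)" .
  have A: "A = Abs_fps (\<lambda>m. if ?p dvd m then E $ m else 0)"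
    by (simp add: A_def fps_multiples_def)
  have "- L * ?T * A = (?T * (S * A)) * E" unfolding LS by (simp only: mult_ac)
  then have "- L * ?T * A = fps_X ^ ?p * E" by (simp add: SA Tc)
  then show ?thesis unfolding laguerre E_def[symmetric] A[symmetric] S[symmetric] using LS by blast
qed

end
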